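(* Let $\mathbf{c}\in\mathbb{R}^n$ with $\mathbf{c}\neq\mathbf{0}$, let $\mathbf{G}\in\mathbb{R}^{m_2\times n}$, $\mathbf{h}\in\mathbb{R}^{m_2}$, let $\mathbf{x}^1,\dots,\mathbf{x}^K\in\mathbb{R}^n$ be observations with $\mathbf{G}\mathbf{x}^k\ge\mathbf{h}$ for all $k$, and let $\mathbf{x}^0$ be the preferred solution. Suppose that $\mathcal{S}=\{\mathbf{x}\in\mathbb{R}^n:\mathbf{c}'\mathbf{x}\ge\mathbf{c}'\mathbf{x}^0,\ \mathbf{G}\mathbf{x}\ge\mathbf{h}\}$ is the set of known constraints of $\mathbf{FO}$, i.e. the known constraints are $\tilde{\mathbf{G}}\mathbf{x}\ge\tilde{\mathbf{h}}$, where $\tilde{\mathbf{G}}\in\mathbb{R}^{(m_2+1)\times n}$ has first row $\mathbf{c}'$ followed by the rows of $\mathbf{G}$, and $\tilde{\mathbf{h}}\in\mathbb{R}^{m_2+1}$ has first entry $\mathbf{c}'\mathbf{x}^0$ followed by the entries of $\mathbf{h}$. Then solving $\mathbf{MIO}$ (with known constraints $\tilde{\mathbf{G}},\tilde{\mathbf{h}}$) is equivalent to solving the problem $$\mathbf{e\text{-}MIO}:\quad \underset{\mathbf{A},\mathbf{b}}{\text{minimize}}\ \ \mathscr{F}(\mathbf{A},\mathbf{b};\mathscr{D})\quad\text{subject to}\quad \mathbf{a}_i'\mathbf{x}^k\ge b_i\ \ \forall i\in\mathcal{I}_1,\ k\in\mathcal{K},\quad \|\mathbf{a}_i\|=1\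 \ \forall i\in\mathcal{I}_1,\quad \mathbf{A}\in\mathbb{R}^{m_1\times n},\ \mathbf{b}\in\mathbb{R}^{m_1},$$ in the following sense: a pair $(\mathbf{A},\mathbf{b})$ is feasible (respectively optimal) for $\mathbf{e\text{-}MIO}$ if and only if there exist $\mathbf{y},\mathbf{w}$ such that $(\mathbf{A},\mathbf{b},\mathbf{y},\mathbf{w})$ is feasible (respectively optimal) for $\mathbf{MIO}$.
   Context: Vector inequalities are componentwise and a prime denotes transpose. Let $m_1\ge 1$ be the number of unknown constraints, $\mathcal{I}_1=\{1,\dots,m_1\}$, $m_2\ge 0$, $\mathcal{K}=\{1,\dots,K\}$ with $K\ge1$, and let $\|\cdot\|$ be a fixed norm on $\mathbb{R}^n$. The forward problem is the linear program $\mathbf{FO}$: minimize $\mathbf{c}'\mathbf{x}$ over $\mathbf{x}\in\mathbb{R}^n$ subject to the unknown constraints $\mathbf{A}\mathbf{x}\ge\mathbf{b}$ and the known constraints. The $i$th row of $\mathbf{A}$ is $\mathbf{a}_i$ and the $i$th entry of $\mathbf{b}$ is $b_i$. The loss function $\mathscr{F}(\mathbf{A},\mathbf{b};\mathscr{D})$ is an arbitrary real-valued function of $(\mathbf{A},\mathbf{b})$, with $\mathscr{D}$ a given input parameter. The preferred solution $\mathbf{x}^0$ is an (arbitrarily selected) element of $\arg\min_{\mathbf{x}^k,\,k\in\mathcal{K}}\{\mathbf{c}'\mathbf{x}^k\}$; it is one of the observations. The multi-point inverse problem $\mathbf{MIO}$ with known constraints $\tilde{\mathbf{G}}\mathbf{x}\ge\tilde{\mathbf{h}}$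 is: minimize $\mathscr{F}(\mathbf{A},\mathbf{b};\mathscr{D})$ over $(\mathbf{A},\mathbf{b},\mathbf{y},\mathbf{w})$ subject to $$\mathbf{A}\mathbf{x}^k\ge\mathbf{b}\ \ \forall k\in\mathcal{K},\qquad \mathbf{c}'\mathbf{x}^0=\mathbf{b}'\mathbf{y}+\tilde{\mathbf{h}}'\mathbf{w},\qquad \mathbf{A}'\mathbf{y}+\tilde{\mathbf{G}}'\mathbf{w}=\mathbf{c},\qquad \|\mathbf{a}_i\|=1\ \ \forall i\in\mathcal{I}_1,$$ $$\mathbf{y}\in\mathbb{R}^{m_1},\ \mathbf{y}\ge\mathbf{0},\quad \mathbf{w}\in\mathbb{R}^{m_2+1},\ \mathbf{w}\ge\mathbf{0},\quad \mathbf{A}\in\mathbb{R}^{m_1\times n},\ \mathbf{b}\in\mathbb{R}^{m_1}.$$ *)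

theory Defs
  imports "Jordan_Normal_Form.Matrix"
begin

definition is_norm :: "nat \<Rightarrow> (real vec \<Rightarrow> real) \<Rightarrow> bool" where
  "is_norm n N \<longleftrightarrow>
     (\<forall>u \<in> carrier_vec n. 0 \<le> N u) \<and>
     (\<forall>u \<in> carrier_vec n. N u = 0 \<longleftrightarrow> u = 0\<^sub>v n) \<and>
     (\<forall>u \<in> carrier_vec n. \<forall>r. N (r \<cdot>\<^sub>v u) = \<bar>r\<bar> * N u) \<and>
     (\<forall>u \<in> carrier_vec n. \<forall>v \<in> carrier_vec n. N (u + v) \<le> N u + N v)"

definition preferred_solution :: "nat \<Rightarrow> real vec \<Rightarrow> (nat \<Rightarrow> real vec) \<Rightarrow> real vec \<Rightarrow> bool" where
  "preferred_solution K c x x0 \<longleftrightarrow> is_arg_min (\<lambda>z. c \<bullet> z) (\<lambda>z. z \<in> x ` {1..K}) x0"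

definition known_mat :: "nat \<Rightarrow> real vec \<Rightarrow> real mat \<Rightarrow> real mat" where
  "known_mat n c G = mat_of_rows n (c # rows G)"

definition known_rhs :: "real vec \<Rightarrow> real vec \<Rightarrow> real vec \<Rightarrow> real vec" where
  "known_rhs c x0 h = vCons (c \<bullet> x0) h"

definition known_set :: "nat \<Rightarrow> real vec \<Rightarrow> real vec \<Rightarrow> real mat \<Rightarrow> real vec \<Rightarrow> real vec set" where
  "known_set n c x0 G h = {z \<in> carrier_vec n. c \<bullet> z \<ge> c \<bullet> x0 \<and> G *\<^sub>v z \<ge> h}"

lemma known_set_eq:
  assumes "c \<in> carrier_vec n" and "G \<in> carrier_mat m2 n" and "h \<in> carrier_vec m2"
  shows "known_set n c x0 G h =
    {z \<in> carrier_vec n. known_mat n c G *\<^sub>v z \<ge> known_rhs c x0 h}"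
proof -
  have row_Suc: "row (known_mat n c G) (Suc i) = row G i" if "i < m2" for i
    using that assms unfolding known_mat_def by (intro eq_vecI) (auto simp: mat_of_rows_index)
  have row_0: "row (known_mat n c G) 0 = c"
    using assms unfolding known_mat_def by (intro eq_vecI) (auto simp: mat_of_rows_index)
  have dim: "dim_row (known_mat n c G) = Suc m2"
    using assms by (simp add: known_mat_def)
  have "known_rhs c x0 h \<le> known_mat n c G *\<^sub>v z \<longleftrightarrow> c \<bullet> x0 \<le> c \<bullet> z \<and> h \<le> G *\<^sub>v z" for z
    using assms row_0 row_Suc dim
    by (auto simp: less_eq_vec_def known_rhs_def vCons_def All_less_Suc2)
  then show ?thesis
    by (auto simp: known_set_def)
qed

(* The order on vectors is componentwise.  Observations are x 1, ..., x K; rows and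
   entries are indexed from 0. *)

definition mio_feasible ::
  "nat \<Rightarrow> nat \<Rightarrow> nat \<Rightarrow> nat \<Rightarrow> (real vec \<Rightarrow> real) \<Rightarrow> real vec \<Rightarrow> (nat \<Rightarrow> real vec) \<Rightarrow> real vec \<Rightarrow>
   real mat \<Rightarrow> real vec \<Rightarrow> (real mat \<times> real vec \<times> real vec \<times> real vec) set" where
  "mio_feasible n m1 m2 K N c x x0 Gt ht =
     {(A, b, y, w).
        A \<in> carrier_mat m1 n \<and> b \<in> carrier_vec m1 \<and>
        y \<in> carrier_vec m1 \<and> y \<ge> 0\<^sub>v m1 \<and>
        w \<in> carrier_vec (m2 + 1) \<and> w \<ge> 0\<^sub>v (m2 + 1) \<and>
        (\<forall>k \<in> {1..K}. A *\<^sub>v x k \<ge> b) \<and>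
        c \<bullet> x0 = b \<bullet> y + ht \<bullet> w \<and>
        A\<^sup>T *\<^sub>v y + Gt\<^sup>T *\<^sub>v w = c \<and>
        (\<forall>i < m1. N (row A i) = 1)}"

definition emio_feasible ::
  "nat \<Rightarrow> nat \<Rightarrow> nat \<Rightarrow> (real vec \<Rightarrow> real) \<Rightarrow> (nat \<Rightarrow> real vec) \<Rightarrow> (real mat \<times> real vec) set" where
  "emio_feasible n m1 K N x =
     {(A, b).
        A \<in> carrier_mat m1 n \<and> b \<in> carrier_vec m1 \<and>
        (\<forall>i < m1. \<forall>k \<in> {1..K}. row A i \<bullet> x k \<ge> b $ i) \<and>
        (\<forall>i < m1. N (row A i) = 1)}"

definition mio_optimal ::
  "(real mat \<Rightarrow> real vec \<Rightarrow> 'd \<Rightarrow> real) \<Rightarrow> 'd \<Rightarrow>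
   nat \<Rightarrow> nat \<Rightarrow> nat \<Rightarrow> nat \<Rightarrow> (real vec \<Rightarrow> real) \<Rightarrow> real vec \<Rightarrow> (nat \<Rightarrow> real vec) \<Rightarrow> real vec \<Rightarrow>
   real mat \<Rightarrow> real vec \<Rightarrow> real mat \<times> real vec \<times> real vec \<times> real vec \<Rightarrow> bool" where
  "mio_optimal F D n m1 m2 K N c x x0 Gt ht =
     is_arg_min (\<lambda>(A, b, y, w). F A b D) (\<lambda>p. p \<in> mio_feasible n m1 m2 K N c x x0 Gt ht)"

definition emio_optimal ::
  "(real mat \<Rightarrow> real vec \<Rightarrow> 'd \<Rightarrow> real) \<Rightarrow> 'd \<Rightarrow>
   nat \<Rightarrow> nat \<Rightarrow> nat \<Rightarrow> (real vec \<Rightarrow> real) \<Rightarrow> (nat \<Rightarrow> real vec) \<Rightarrow> real mat \<times> real vec \<Rightarrow> bool" where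
  "emio_optimal F D n m1 K N x =
     is_arg_min (\<lambda>(A, b). F A b D) (\<lambda>p. p \<in> emio_feasible n m1 K N x)"

end

theory Submission
  imports Defs
begin

text \<open>The first row of the known constraints is \<open>c\<close> itself, with right-hand side
  \<open>c \<bullet> x0\<close>, so \<open>y = 0\<close> together with the first unit vector for \<open>w\<close> satisfies strong duality
  and dual feasibility for every \<open>(A, b)\<close>.\<close>

lemma known_mat_carrier:
  assumes "G \<in> carrier_mat m n"
  shows "known_mat n c G \<in> carrier_mat (Suc m) n"
  using assms by (intro carrier_matI) (auto simp: known_mat_def)

text \<open>Each entry of the product is a column paired with the first unit vector, which leaves
  that column's entry in row 0, where \<open>known_mat\<close> puts \<open>c\<close>.\<close>

lemma known_mat_transpose_unit_vec:
  assumes "c \<in> carrier_vec n" and "G \<in> carrier_mat m n"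
  shows "(known_mat n c G)\<^sup>T *\<^sub>v unit_vec (Suc m) 0 = c"
proof (rule eq_vecI)
  note M = known_mat_carrier[OF assms(2), of c]
  fix j assume "j < dim_vec c"
  then have j: "j < n" using assms by simp
  have "((known_mat n c G)\<^sup>T *\<^sub>v unit_vec (Suc m) 0) $ j = col (known_mat n c G) j \<bullet> unit_vec (Suc m) 0"
    using M j by simp
  also have "\<dots> = col (known_mat n c G) j $ 0"
    using M by (intro scalar_prod_right_unit) auto
  also have "\<dots> = c $ j"
    using assms M j by (simp add: known_mat_def mat_of_rows_index)
  finally show "((known_mat n c G)\<^sup>T *\<^sub>v unit_vec (Suc m) 0) $ j = c $ j" .
qed (use known_mat_carrier[OF assms(2), of c] assms in auto)

lemma known_rhs_unit_vec:
  assumes "h \<in> carrier_vec m"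
  shows "known_rhs c x0 h \<bullet> unit_vec (Suc m) 0 = c \<bullet> x0"
proof -
  have "known_rhs c x0 h \<in> carrier_vec (Suc m)"
    using assms by (simp add: known_rhs_def)
  then have "known_rhs c x0 h \<bullet> unit_vec (Suc m) 0 = known_rhs c x0 h $ 0"
    by (intro scalar_prod_right_unit) auto
  then show ?thesis by (simp add: known_rhs_def)
qed

text \<open>Bridges the two ways of writing primal feasibility: \<open>mio_feasible\<close> uses the
  matrix product, \<open>emio_feasible\<close> uses single rows.\<close>

lemma mult_mat_vec_ge_iff:
  assumes "A \<in> carrier_mat m n" and "b \<in> carrier_vec m"
  shows "A *\<^sub>v z \<ge> b \<longleftrightarrow> (\<forall>i < m. row A i \<bullet> z \<ge> b $ i)"
  using assms by (auto simp: less_eq_vec_def)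

lemma emio_feasible_iff_mio_feasible:
  assumes c: "c \<in> carrier_vec n" and G: "G \<in> carrier_mat m2 n" and h: "h \<in> carrier_vec m2"
  shows "(A, b) \<in> emio_feasible n m1 K N x \<longleftrightarrow>
    (\<exists>y w. (A, b, y, w) \<in> mio_feasible n m1 m2 K N c x x0 (known_mat n c G) (known_rhs c x0 h))"
    (is "?L \<longleftrightarrow> (\<exists>y w. ?R y w)")
proof
  assume L: ?L
  then have A: "A \<in> carrier_mat m1 n" and b: "b \<in> carrier_vec m1"
    by (auto simp: emio_feasible_def)
  \<comment> \<open>With zero multipliers the unknown constraints drop out of the dual equation, so
    the known constraints alone must produce \<open>c\<close>.\<close>
  have "A\<^sup>T *\<^sub>v 0\<^sub>v m1 = 0\<^sub>v n"
    using A by (intro eq_vecI) auto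
  then have "?R (0\<^sub>v m1) (unit_vec (Suc m2) 0)"
    using L A b c known_mat_transpose_unit_vec[OF c G] known_rhs_unit_vec[OF h, of c x0]
    by (auto simp: mio_feasible_def emio_feasible_def mult_mat_vec_ge_iff[OF A b] less_eq_vec_def)
  then show "\<exists>y w. ?R y w" by blast
next
  assume "\<exists>y w. ?R y w"
  then obtain y w where R: "?R y w" by blast
  then have A: "A \<in> carrier_mat m1 n" and b: "b \<in> carrier_vec m1"
    by (auto simp: mio_feasible_def)
  \<comment> \<open>Projection: the conditions involving \<open>y\<close> and \<open>w\<close> are
    forgotten, and the remaining ones are those of \<open>emio_feasible\<close>.\<close>
  show ?L
    using R by (simp add: mio_feasible_def emio_feasible_def mult_mat_vec_ge_iff[OF A b])
qed

theorem theorem1: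
  fixes n m1 m2 K :: nat
    and N :: "real vec \<Rightarrow> real"
    and F :: "real mat \<Rightarrow> real vec \<Rightarrow> 'd \<Rightarrow> real" and D :: 'd
    and c h x0 ht :: "real vec"
    and G Gt :: "real mat"
    and x :: "nat \<Rightarrow> real vec"
  assumes "m1 \<ge> 1" and "K \<ge> 1"
    and "is_norm n N"
    and "c \<in> carrier_vec n" and "c \<noteq> 0\<^sub>v n"
    and "G \<in> carrier_mat m2 n" and "h \<in> carrier_vec m2"
    and "\<And>k. k \<in> {1..K} \<Longrightarrow> x k \<in> carrier_vec n"
    and "\<And>k. k \<in> {1..K} \<Longrightarrow> G *\<^sub>v x k \<ge> h"
    and "preferred_solution K c x x0"
    and "Gt = known_mat n c G" and "ht = known_rhs c x0 h"
  shows "\<forall>A b.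
     ((A, b) \<in> emio_feasible n m1 K N x \<longleftrightarrow>
        (\<exists>y w. (A, b, y, w) \<in> mio_feasible n m1 m2 K N c x x0 Gt ht)) \<and>
     (emio_optimal F D n m1 K N x (A, b) \<longleftrightarrow>
        (\<exists>y w. mio_optimal F D n m1 m2 K N c x x0 Gt ht (A, b, y, w)))"
proof (intro allI conjI)
  fix A b
  \<comment> \<open>The pair stays schematic, so that the equivalence also rewrites the competing
    pairs in the definition of optimality.\<close>
  note feas = emio_feasible_iff_mio_feasible
    [OF assms(4,6,7), of _ _ m1 K N x x0, folded assms(11,12)]
  show "(A, b) \<in> emio_feasible n m1 K N x \<longleftrightarrow>
      (\<exists>y w. (A, b, y, w) \<in> mio_feasible n m1 m2 K N c x x0 Gt ht)"
    by (rule feas)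
  show "emio_optimal F D n m1 K N x (A, b) \<longleftrightarrow>
      (\<exists>y w. mio_optimal F D n m1 m2 K N c x x0 Gt ht (A, b, y, w))"
    \<comment> \<open>Optimal means feasible with no strictly better feasible point. The objective
      ignores \<open>y\<close> and \<open>w\<close>, so a better pair extends to a better quadruple,
      and a better quadruple projects to a better pair.\<close>
    unfolding emio_optimal_def mio_optimal_def is_arg_min_def
    by (simp only: split_paired_Ex prod.case feas) blast
qed

end
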